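(* Let $G$ be a $d$-regular directed graph on $2n$ vertices, and let $\pi$ be an equitable partition of $V(G)$ into $n$ cells of equal size. Let $\tau$ and $\sigma$ be the arc partitions of $LD(G)$ and $LD(G/\pi)$ into cells of equal size, with normalized characteristic matrices $Q_\tau$ and $\widetilde Q$ satisfying $$Q_\tau=I_d\otimes\widetilde Q,\qquad \widetilde Q=Q,$$ where $Q$ is the normalized characteristic matrix of $\pi$. Let $U$ and $\widetilde U$ be the transition operators of $G$ and $G/\pi$ defined in the context, built from shunt decompositions with $P_jQ=Q\widetilde P_j$ for $j=1,\dots,d$. Then for all $x,y\in\operatorname{Im}(\widetilde Q)$, $U$ exhibits perfect state transfer from $Q_\tau x$ to $Q_\tau y$ at time $k$ if and only if $\widetilde U$ exhibits perfect state transfer from $x$ to $y$ at time $k$.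
   Context: $G$ is $d$-regular if all in- and out-degrees equal $d$. A vertex partition $\{C_1,\dots,C_n\}$ is equitable if every vertex of $C_i$ has the same number $b_{ij}$ of out-neighbours in $C_j$; $G/\pi$ is the directed multigraph with adjacency matrix $\widetilde A=(b_{ij})$ (here $d$-regular). $LD(\cdot)$ is the line digraph: vertices are arcs, and $a\to b$ iff the head of $a$ is the tail of $b$; an arc partition is a partition of its vertex set. The partitions $\tau$ and $\sigma$ are equitable and group the arcs of $G$, respectively $G/\pi$, by terminal vertex. The normalized characteristic matrix of a partition has one column per cell, the indicator vector of the cell divided by the square root of its size, so its columns are orthonormal. Shunt decompositions are $A=\sum_{j=1}^d P_j$ and $\widetilde A=\sum_{j=1}^d\widetilde P_j$, with $A$ the adjacency matrix of $G$ and $P_j,\widetilde P_j$ permutation matrices. With $E_{jj}$ the $d\times d$ diagonal matrix units, $S=\sum_j E_{jj}\otimes P_j$ and $\widetilde S=\sum_jE_{jj}\otimes\widetilde P_j$. The reflections are $R=2Q_\tau(\widetilde Q\widetilde Q^\top)Q_\tau^\top-I$ and $\widetilde R=2\widetilde Q\widetilde Q^\top-I$, and $U=SR$, $\widetilde U=\widetilde S\widetilde R$. (Arcs are ordered so that the sizes agree: $\widetilde Q$ has size $nd\times n$, $Q$ has size $2n\times n$.) A unitary $W$ exhibits perfect state transfer from a unit vector $x$ to a unit vector $y$ at time $k$ (a non-negative integer) if $W^kx=\gamma y$ for some $\gamma\in\mathbb C$ with $|\gamma|=1$. *)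

theory Defs
  imports
    "Jordan_Normal_Form.Schur_Decomposition"
    "Graph_Theory.Digraph"
    "HOL-Library.Disjoint_Sets"
begin

definition regular_digraph :: "nat \<Rightarrow> ('a, 'b) pre_digraph \<Rightarrow> bool" where
  "regular_digraph d G \<longleftrightarrow> (\<forall>v \<in> verts G. in_degree G v = d \<and> out_degree G v = d)"

text \<open>Out-neighbours are counted as vertices; the notion is only used for digraphs without
  parallel arcs.\<close>

definition num_out_nbrs :: "('a, 'b) pre_digraph \<Rightarrow> 'a \<Rightarrow> 'a set \<Rightarrow> nat" where
  "num_out_nbrs G v D = card {w \<in> D. v \<rightarrow>\<^bsub>G\<^esub> w}"

definition equitable_partition :: "('a, 'b) pre_digraph \<Rightarrow> 'a set set \<Rightarrow> bool" where
  "equitable_partition G \<pi> \<longleftrightarrow> partition_on (verts G) \<pi> \<and>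
     (\<forall>C \<in> \<pi>. \<forall>D \<in> \<pi>. \<exists>b. \<forall>v \<in> C. num_out_nbrs G v D = b)"

definition equal_cells :: "'a set set \<Rightarrow> bool" where
  "equal_cells \<pi> \<longleftrightarrow> (\<forall>C \<in> \<pi>. \<forall>D \<in> \<pi>. card C = card D)"

text \<open>The number \<open>b\<^sub>i\<^sub>j\<close> of an equitable partition; unique because the cells are nonempty.\<close>

definition cell_degree :: "('a, 'b) pre_digraph \<Rightarrow> 'a set \<Rightarrow> 'a set \<Rightarrow> nat" where
  "cell_degree G C D = (THE b. \<forall>v \<in> C. num_out_nbrs G v D = b)"

text \<open>The quotient multigraph has the cells as vertices, and \<open>b\<^sub>i\<^sub>j\<close> parallel arcs, told apart
  by a label, from the \<open>i\<close>-th to the \<open>j\<close>-th cell.\<close>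

definition quotient_digraph ::
  "('a, 'b) pre_digraph \<Rightarrow> 'a set set \<Rightarrow> ('a set, 'a set \<times> 'a set \<times> nat) pre_digraph" where
  "quotient_digraph G \<pi> =
     \<lparr> verts = \<pi>,
       arcs = {(C, D, l). C \<in> \<pi> \<and> D \<in> \<pi> \<and> l < cell_degree G C D},
       tail = (\<lambda>(C, D, l). C),
       head = (\<lambda>(C, D, l). D) \<rparr>"

definition line_digraph :: "('a, 'b) pre_digraph \<Rightarrow> ('b, 'b \<times> 'b) pre_digraph" where
  "line_digraph G =
     \<lparr> verts = arcs G,
       arcs = {(a, b). a \<in> arcs G \<and> b \<in> arcs G \<and> head G a = tail G b},
       tail = fst,
       head = snd \<rparr>"

definition terminal_partition :: "('a, 'b) pre_digraph \<Rightarrow> 'b set set" where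
  "terminal_partition G = in_arcs G ` head G ` arcs G"

text \<open>Matrices indexed by vertices, arcs or cells are taken with respect to an ordering of the
  index set, given as a list without repetitions.\<close>

definition ordering_of :: "'a list \<Rightarrow> 'a set \<Rightarrow> bool" where
  "ordering_of xs A \<longleftrightarrow> distinct xs \<and> set xs = A"

definition adjacency_mat :: "('a, 'b) pre_digraph \<Rightarrow> 'a list \<Rightarrow> complex mat" where
  "adjacency_mat G vs = mat (length vs) (length vs)
     (\<lambda>(i, j). of_nat (card {e \<in> arcs G. tail G e = vs ! i \<and> head G e = vs ! j}))"

definition normalized_char_mat :: "'a list \<Rightarrow> 'a set list \<Rightarrow> complex mat" where
  "normalized_char_mat xs cs = mat (length xs) (length cs)
     (\<lambda>(i, j). if xs ! i \<in> cs ! j then complex_of_real (1 / sqrt (card (cs ! j))) else 0)"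

definition kronecker :: "complex mat \<Rightarrow> complex mat \<Rightarrow> complex mat" (infixl \<open>\<otimes>\<^sub>m\<close> 75) where
  "A \<otimes>\<^sub>m B = mat (dim_row A * dim_row B) (dim_col A * dim_col B)
     (\<lambda>(i, j). A $$ (i div dim_row B, j div dim_col B) * B $$ (i mod dim_row B, j mod dim_col B))"

definition diag_unit :: "nat \<Rightarrow> nat \<Rightarrow> complex mat" where
  "diag_unit d j = mat d d (\<lambda>(r, s). if r = j \<and> s = j then 1 else 0)"

definition matrix_sum :: "nat \<Rightarrow> nat \<Rightarrow> (nat \<Rightarrow> complex mat) \<Rightarrow> complex mat" where
  "matrix_sum N d M = mat N N (\<lambda>(r, s). \<Sum>j<d. M j $$ (r, s))"

definition permutation_matrix :: "nat \<Rightarrow> complex mat \<Rightarrow> bool" where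
  "permutation_matrix N P \<longleftrightarrow> P \<in> carrier_mat N N \<and>
     (\<forall>i<N. \<forall>j<N. P $$ (i, j) \<in> {0, 1}) \<and>
     (\<forall>i<N. \<exists>!j. j < N \<and> P $$ (i, j) = 1) \<and>
     (\<forall>j<N. \<exists>!i. i < N \<and> P $$ (i, j) = 1)"

definition shunt_decomposition :: "nat \<Rightarrow> nat \<Rightarrow> complex mat \<Rightarrow> (nat \<Rightarrow> complex mat) \<Rightarrow> bool" where
  "shunt_decomposition N d A P \<longleftrightarrow>
     (\<forall>j<d. permutation_matrix N (P j)) \<and> A = matrix_sum N d P"

definition unitary_matrix :: "complex mat \<Rightarrow> bool" where
  "unitary_matrix W \<longleftrightarrow> square_mat W \<and>
     mat_adjoint W * W = 1\<^sub>m (dim_row W) \<and> W * mat_adjoint W = 1\<^sub>m (dim_row W)"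

definition unit_vector :: "nat \<Rightarrow> complex vec \<Rightarrow> bool" where
  "unit_vector N x \<longleftrightarrow> x \<in> carrier_vec N \<and> x \<bullet>c x = 1"

definition perfect_state_transfer ::
  "complex mat \<Rightarrow> complex vec \<Rightarrow> complex vec \<Rightarrow> nat \<Rightarrow> bool" where
  "perfect_state_transfer W x y k \<longleftrightarrow>
     unitary_matrix W \<and> unit_vector (dim_row W) x \<and> unit_vector (dim_row W) y \<and>
     (\<exists>\<gamma>. cmod \<gamma> = 1 \<and> (W ^\<^sub>m k) *\<^sub>v x = \<gamma> \<cdot>\<^sub>v y)"

definition mat_image :: "complex mat \<Rightarrow> complex vec set" where
  "mat_image M = {M *\<^sub>v z | z. z \<in> carrier_vec (dim_col M)}"

end

theory Submission
  imports Defs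
begin

text \<open>The matrix \<open>Q\<tau> = I \<otimes> Q\<close> is a real isometry that intertwines the two walks.
  Indeed \<open>S\<close>, \<open>S'\<close> and \<open>Q\<tau>\<close> are block diagonal with blocks \<open>P\<^sub>j\<close>, \<open>P'\<^sub>j\<close> and \<open>Q\<close>, so
  \<open>P\<^sub>j Q = Q P'\<^sub>j\<close> gives \<open>S Q\<tau> = Q\<tau> S'\<close>; and \<open>Q\<tau>\<^sup>T Q\<tau> = I\<close> gives \<open>R Q\<tau> = Q\<tau> R'\<close>.
  Hence \<open>U\<^sup>k Q\<tau> = Q\<tau> U'\<^sup>k\<close>, and \<open>Q\<tau>\<close> can be cancelled on the left. Both walks are unitary:
  the shifts are built from permutation matrices, and both reflections have the form
  \<open>2 V V\<^sup>T - I\<close> with \<open>V\<^sup>T V = I\<close>, where \<open>V = Q\<tau> Q\<close> and \<open>V = Q\<close> respectively.\<close>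

section \<open>Block diagonal matrices\<close>

text \<open>The blocks may vary and may be rectangular, so this one form covers both the shifts,
  with square blocks, and \<open>Q\<tau>\<close>, with tall ones. Indices split into quotient and
  remainder as in \<open>kronecker\<close>.\<close>

definition block_diag :: "nat \<Rightarrow> nat \<Rightarrow> nat \<Rightarrow> (nat \<Rightarrow> complex mat) \<Rightarrow> complex mat" where
  "block_diag d m n B = mat (d * m) (d * n)
     (\<lambda>(i, j). if i div m = j div n then B (i div m) $$ (i mod m, j mod n) else 0)"

lemma block_diag_carrier [simp]: "block_diag d m n B \<in> carrier_mat (d * m) (d * n)"
  by (simp add: block_diag_def)

text \<open>The range is cut into \<open>d\<close> consecutive intervals of length \<open>n\<close>:
  on the \<open>a\<close>-th one the quotient is constantly \<open>a\<close> and the remainder runs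
  once through all \<open>b < n\<close>.\<close>

lemma sum_div_mod:
  fixes f :: "nat \<Rightarrow> nat \<Rightarrow> 'a::comm_monoid_add"
  shows "(\<Sum>k<d * n. f (k div n) (k mod n)) = (\<Sum>a<d. \<Sum>b<n. f a b)"
proof -
  have "(\<Sum>k = a * n..<a * n + n. f (k div n) (k mod n)) = (\<Sum>b<n. f a b)" for a
  proof -
    have "(\<Sum>k = a * n..<a * n + n. f (k div n) (k mod n)) =
      (\<Sum>b\<in>{0..<n}. f ((b + a * n) div n) ((b + a * n) mod n))"
      using sum.shift_bounds_nat_ivl[of "\<lambda>k. f (k div n) (k mod n)" 0 "a * n" n]
      by (simp only: add_0 add.commute[of n])
    also have "\<dots> = (\<Sum>b<n. f a b)"
      unfolding lessThan_atLeast0 by (rule sum.cong) auto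
    finally show ?thesis .
  qed
  then show ?thesis
    unfolding sum.nat_group[symmetric] by (rule sum.cong[OF refl])
qed

lemma div_less_mod_less:
  fixes i :: nat
  assumes "i < d * m"
  shows "i div m < d" and "i mod m < m"
proof -
  have "m > 0" using assms by (cases m) auto
  then show "i div m < d" "i mod m < m"
    using assms by (auto simp: less_mult_imp_div_less)
qed

lemma div_mod_eqD:
  fixes i j :: nat
  assumes "i div n = j div n" and "i mod n = j mod n"
  shows "i = j"
  by (metis assms div_mult_mod_eq)

lemma block_diag_cong:
  assumes "\<And>a. a < d \<Longrightarrow> A a = B a"
  shows "block_diag d m n A = block_diag d m n B"
  using assms by (intro eq_matI) (auto simp: block_diag_def div_less_mod_less)

text \<open>With the summation index split into a block \<open>a\<close> and a position
  \<open>b\<close>, the first factor vanishes unless \<open>a\<close> is the block of the row, the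
  second unless \<open>a\<close> is the block of the column.\<close>

lemma block_diag_mult:
  assumes A: "\<And>a. a < d \<Longrightarrow> A a \<in> carrier_mat m n"
    and B: "\<And>a. a < d \<Longrightarrow> B a \<in> carrier_mat n p"
  shows "block_diag d m n A * block_diag d n p B = block_diag d m p (\<lambda>a. A a * B a)"
proof (intro eq_matI)
  fix i j assume "i < dim_row (block_diag d m p (\<lambda>a. A a * B a))"
    and "j < dim_col (block_diag d m p (\<lambda>a. A a * B a))"
  then have i: "i < d * m" and j: "j < d * p"
    by (auto simp: block_diag_def)
  note i' = div_less_mod_less[OF i] and j' = div_less_mod_less[OF j]
  let ?a = "i div m"
  let ?f = "\<lambda>a b. (if ?a = a then A ?a $$ (i mod m, b) else 0) *
                   (if a = j div p then B a $$ (b, j mod p) else 0)"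
  have "(block_diag d m n A * block_diag d n p B) $$ (i, j) = (\<Sum>k<d * n. ?f (k div n) (k mod n))"
    using i j by (auto simp: block_diag_def scalar_prod_def lessThan_atLeast0 intro!: sum.cong)
  also have "\<dots> = (\<Sum>a<d. \<Sum>b<n. ?f a b)"
    by (rule sum_div_mod)
  also have "\<dots> = (\<Sum>a<d. if a = ?a then (\<Sum>b<n. ?f a b) else 0)"
    by (intro sum.cong) auto
  also have "\<dots> = (\<Sum>b<n. ?f ?a b)"
    using i' by simp
  also have "\<dots> = (if ?a = j div p then (A ?a * B ?a) $$ (i mod m, j mod p) else 0)"
    using A[OF i'(1)] B[OF i'(1)] i' j'
    by (auto simp: scalar_prod_def lessThan_atLeast0 intro!: sum.cong)
  also have "\<dots> = block_diag d m p (\<lambda>a. A a * B a) $$ (i, j)"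
    using i j by (simp add: block_diag_def)
  finally show "(block_diag d m n A * block_diag d n p B) $$ (i, j) =
    block_diag d m p (\<lambda>a. A a * B a) $$ (i, j)" .
qed (auto simp: block_diag_def)

lemma block_diag_one: "block_diag d n n (\<lambda>_. 1\<^sub>m n) = 1\<^sub>m (d * n)"
  by (intro eq_matI) (auto simp: block_diag_def div_less_mod_less dest: div_mod_eqD)

lemma transpose_block_diag:
  assumes "\<And>a. a < d \<Longrightarrow> B a \<in> carrier_mat m n"
  shows "transpose_mat (block_diag d m n B) = block_diag d n m (\<lambda>a. transpose_mat (B a))"
proof (intro eq_matI)
  fix i j assume "i < dim_row (block_diag d n m (\<lambda>a. transpose_mat (B a)))"
    and "j < dim_col (block_diag d n m (\<lambda>a. transpose_mat (B a)))"
  then have i: "i < d * n" and j: "j < d * m"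
    by (auto simp: block_diag_def)
  then show "transpose_mat (block_diag d m n B) $$ (i, j) =
    block_diag d n m (\<lambda>a. transpose_mat (B a)) $$ (i, j)"
    using div_less_mod_less[OF i] div_less_mod_less[OF j] assms[of "i div n"]
    by (auto simp: block_diag_def)
qed (auto simp: block_diag_def)

lemma kronecker_one_left:
  assumes "B \<in> carrier_mat m n"
  shows "1\<^sub>m d \<otimes>\<^sub>m B = block_diag d m n (\<lambda>_. B)"
  using assms by (intro eq_matI) (auto simp: kronecker_def block_diag_def div_less_mod_less)

text \<open>The \<open>j\<close>-th summand is supported on the \<open>j\<close>-th diagonal block,
  so at every entry at most one summand contributes.\<close>

lemma matrix_sum_diag_unit_kronecker:
  assumes P: "\<And>j. j < d \<Longrightarrow> P j \<in> carrier_mat N N"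
  shows "matrix_sum (d * N) d (\<lambda>j. diag_unit d j \<otimes>\<^sub>m P j) = block_diag d N N P"
proof (intro eq_matI)
  fix i j assume "i < dim_row (block_diag d N N P)" and "j < dim_col (block_diag d N N P)"
  then have i: "i < d * N" and j: "j < d * N"
    by (auto simp: block_diag_def)
  note i' = div_less_mod_less[OF i] and j' = div_less_mod_less[OF j]
  have "(diag_unit d a \<otimes>\<^sub>m P a) $$ (i, j) =
    (if a = i div N then (if i div N = j div N then P a $$ (i mod N, j mod N) else 0) else 0)"
    if "a < d" for a
    using i j i' j' P[OF that] by (auto simp: kronecker_def diag_unit_def)
  then have "matrix_sum (d * N) d (\<lambda>j. diag_unit d j \<otimes>\<^sub>m P j) $$ (i, j) =
    (\<Sum>a<d. if a = i div N then (if i div N = j div N then P a $$ (i mod N, j mod N) else 0) else 0)"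
    using i j by (simp add: matrix_sum_def)
  also have "\<dots> = block_diag d N N P $$ (i, j)"
    using i j i' by (simp add: block_diag_def)
  finally show "matrix_sum (d * N) d (\<lambda>j. diag_unit d j \<otimes>\<^sub>m P j) $$ (i, j) =
    block_diag d N N P $$ (i, j)" .
qed (auto simp: matrix_sum_def block_diag_def)

section \<open>Real orthogonal matrices\<close>

text \<open>Reality is a predicate on complex matrices, because states, phases and unitarity live
  over the complex numbers. It turns adjoints into transposes.\<close>

definition real_mat :: "complex mat \<Rightarrow> bool" where
  "real_mat A \<longleftrightarrow> (\<forall>i<dim_row A. \<forall>j<dim_col A. A $$ (i, j) \<in> \<real>)"

lemma real_mat_mult:
  assumes "real_mat A" and "real_mat B" and "dim_col A = dim_row B"
  shows "real_mat (A * B)"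
  using assms by (auto simp: real_mat_def scalar_prod_def intro!: sum_in_Reals Reals_mult)

lemma real_mat_transpose: "real_mat A \<Longrightarrow> real_mat (transpose_mat A)"
  by (auto simp: real_mat_def)

lemma real_mat_block_diag:
  assumes "\<And>a. a < d \<Longrightarrow> B a \<in> carrier_mat m n" and "\<And>a. a < d \<Longrightarrow> real_mat (B a)"
  shows "real_mat (block_diag d m n B)"
  unfolding real_mat_def
proof (intro allI impI)
  fix i j assume "i < dim_row (block_diag d m n B)" and "j < dim_col (block_diag d m n B)"
  then have i: "i < d * m" and j: "j < d * n"
    by (auto simp: block_diag_def)
  then show "block_diag d m n B $$ (i, j) \<in> \<real>"
    using assms[of "i div m"] div_less_mod_less[OF i] div_less_mod_less[OF j]
    by (auto simp: block_diag_def real_mat_def)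
qed

lemma mat_adjoint_real_mat: "real_mat A \<Longrightarrow> mat_adjoint A = transpose_mat A"
  by (intro eq_matI) (auto simp: mat_adjoint_def mat_of_rows_def real_mat_def Reals_cnj_iff)

text \<open>A left inverse of a square matrix is also a right inverse, so one of the two identities
  of unitarity suffices.\<close>

lemma unitary_matrixI_real:
  assumes W: "W \<in> carrier_mat N N" and "real_mat W" and "transpose_mat W * W = 1\<^sub>m N"
  shows "unitary_matrix W"
proof -
  have "W * transpose_mat W = 1\<^sub>m N"
    using mat_mult_left_right_inverse[of "transpose_mat W" N W] assms by simp
  then show ?thesis
    using assms by (auto simp: unitary_matrix_def mat_adjoint_real_mat)
qed

text \<open>The inner product \<open>A^T A\<close> cancels in \<open>B^T (A^T A) B\<close>.
  Rectangular factors are allowed: this serves products of orthogonal matrices as well as the tall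
  product \<open>Q\<tau> * Q\<close>.\<close>

lemma transpose_mult_orthogonal:
  fixes A :: "'a::comm_semiring_1 mat"
  assumes A: "A \<in> carrier_mat l m" and B: "B \<in> carrier_mat m n"
    and "transpose_mat A * A = 1\<^sub>m m" and "transpose_mat B * B = 1\<^sub>m n"
  shows "transpose_mat (A * B) * (A * B) = 1\<^sub>m n"
proof -
  have "transpose_mat (A * B) * (A * B) = transpose_mat B * ((transpose_mat A * A) * B)"
    using A B by (simp add: transpose_mult[OF A B] assoc_mult_mat[of _ n m _ l _ n]
      assoc_mult_mat[of _ m l _ m _ n])
  then show ?thesis
    using assms by simp
qed

lemma unitary_matrix_mult_real:
  assumes A: "A \<in> carrier_mat N N" "real_mat A" "transpose_mat A * A = 1\<^sub>m N"
    and B: "B \<in> carrier_mat N N" "real_mat B" "transpose_mat B * B = 1\<^sub>m N"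
  shows "unitary_matrix (A * B)"
  using assms transpose_mult_orthogonal[of A N N B N]
  by (intro unitary_matrixI_real[of _ N]) (auto intro: real_mat_mult)

lemma real_mat_permutation: "permutation_matrix N P \<Longrightarrow> real_mat P"
  unfolding permutation_matrix_def real_mat_def
  by (metis Reals_0 Reals_1 carrier_matD empty_iff insert_iff)

text \<open>Column \<open>i\<close> has its only 1 in some row \<open>k\<close>, so the
  \<open>(i, j)\<close> entry of the product is \<open>P $$ (k, j)\<close>. Since row
  \<open>k\<close> has its only 1 in column \<open>i\<close>, this is 1 exactly for
  \<open>j = i\<close>.\<close>

lemma transpose_mult_permutation:
  assumes P: "permutation_matrix N P"
  shows "transpose_mat P * P = 1\<^sub>m N"
proof (intro eq_matI)
  fix i j assume "i < dim_row (1\<^sub>m N :: complex mat)" and "j < dim_col (1\<^sub>m N :: complex mat)"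
  then have i: "i < N" and j: "j < N" by auto
  have PN: "P \<in> carrier_mat N N" and P01: "\<And>i j. i < N \<Longrightarrow> j < N \<Longrightarrow> P $$ (i, j) = 0 \<or> P $$ (i, j) = 1"
    and row: "\<And>i. i < N \<Longrightarrow> \<exists>!j. j < N \<and> P $$ (i, j) = 1"
    and col: "\<And>j. j < N \<Longrightarrow> \<exists>!i. i < N \<and> P $$ (i, j) = 1"
    using P by (auto simp: permutation_matrix_def)
  obtain k where k: "k < N" "P $$ (k, i) = 1" and k_uniq: "\<And>l. l < N \<Longrightarrow> P $$ (l, i) = 1 \<Longrightarrow> l = k"
    using col[OF i] by blast
  have "(transpose_mat P * P) $$ (i, j) = (\<Sum>l<N. P $$ (l, i) * P $$ (l, j))"
    using i j PN by (simp add: scalar_prod_def lessThan_atLeast0)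
  also have "\<dots> = (\<Sum>l<N. if l = k then P $$ (k, j) else 0)"
  proof (rule sum.cong[OF refl])
    fix l assume "l \<in> {..<N}"
    then have "l \<noteq> k \<Longrightarrow> P $$ (l, i) = 0"
      using P01[OF _ i] k_uniq by blast
    then show "P $$ (l, i) * P $$ (l, j) = (if l = k then P $$ (k, j) else 0)"
      using k by simp
  qed
  also have "\<dots> = P $$ (k, j)"
    using k by simp
  also have "\<dots> = 1\<^sub>m N $$ (i, j)"
    using i j k P01[OF k(1) j] row[OF k(1)] by auto
  finally show "(transpose_mat P * P) $$ (i, j) = 1\<^sub>m N $$ (i, j)" .
qed (use P in \<open>auto simp: permutation_matrix_def\<close>)

text \<open>\<open>M = V V^T\<close> is the orthogonal projection onto the column space of
  \<open>V\<close>. It is symmetric and idempotent, so \<open>R\<close> is symmetric and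
  \<open>R^2 = 4 M^2 - 4 M + I = I\<close>.\<close>

lemma reflection_real_orthogonal:
  assumes V: "V \<in> carrier_mat N n" and "real_mat V" and VV: "transpose_mat V * V = 1\<^sub>m n"
  defines "R \<equiv> 2 \<cdot>\<^sub>m (V * transpose_mat V) - 1\<^sub>m N"
  shows "R \<in> carrier_mat N N" and "real_mat R" and "transpose_mat R * R = 1\<^sub>m N"
proof -
  let ?M = "V * transpose_mat V"
  have M: "?M \<in> carrier_mat N N" using V by simp
  then show R: "R \<in> carrier_mat N N" by (auto simp: R_def intro: minus_carrier_mat)
  have "real_mat ?M"
    using assms by (auto intro: real_mat_mult real_mat_transpose)
  then show "real_mat R"
    using V by (auto simp: R_def real_mat_def intro!: Reals_diff Reals_mult)
  have MT: "transpose_mat ?M = ?M"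
    using V by (simp add: transpose_mult[of V N n _ N])
  have RT: "transpose_mat R = R"
  proof (intro eq_matI)
    fix i j assume ij: "i < dim_row R" "j < dim_col R"
    then have "i < N" "j < N" using R by auto
    then have "?M $$ (j, i) = ?M $$ (i, j)"
      using arg_cong[OF MT, of "\<lambda>A. A $$ (i, j)"] M by (metis carrier_matD index_transpose_mat(1))
    then show "transpose_mat R $$ (i, j) = R $$ (i, j)"
      using R M \<open>i < N\<close> \<open>j < N\<close> by (auto simp: R_def)
  qed (use R in auto)
  have "?M * ?M = V * ((transpose_mat V * V) * transpose_mat V)"
    using V by (simp add: assoc_mult_mat[of _ N n _ N _ N] assoc_mult_mat[of _ n N _ n _ N])
  then have MM: "?M * ?M = ?M"
    using V VV by simp
  \<comment> \<open>The square is expanded one factor at a time; idempotence of \<open>M\<close>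
    enters only in the last equation.\<close>
  have "R * R = 2 \<cdot>\<^sub>m (?M * R) - R"
    using M R by (subst R_def) (simp add: minus_mult_distrib_mat[of _ N N _ _ N] mult_smult_assoc_mat[of _ N N _ N])
  also have "?M * R = 2 \<cdot>\<^sub>m (?M * ?M) - ?M"
    using M by (simp add: R_def right_mult_one_mat[OF M] mult_minus_distrib_mat[of _ N N _ N] mult_smult_distrib[of _ N N _ N])
  also have "2 \<cdot>\<^sub>m (2 \<cdot>\<^sub>m (?M * ?M) - ?M) - R = 1\<^sub>m N"
    unfolding MM R_def using M by (intro eq_matI) (auto simp: algebra_simps)
  finally show "transpose_mat R * R = 1\<^sub>m N"
    by (simp add: RT)
qed

section \<open>Normalized characteristic matrices\<close>

lemma real_mat_normalized_char_mat: "real_mat (normalized_char_mat xs cs)"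
  by (auto simp: real_mat_def normalized_char_mat_def)

text \<open>Distinct cells are disjoint, so their columns have disjoint supports; a cell with
  \<open>c\<close> elements contributes \<open>c\<close> terms \<open>1 / c\<close> to its diagonal
  entry.\<close>

lemma transpose_mult_normalized_char_mat:
  assumes xs: "ordering_of xs A" and cs: "ordering_of cs \<pi>" and \<pi>: "partition_on A \<pi>"
  shows "transpose_mat (normalized_char_mat xs cs) * normalized_char_mat xs cs = 1\<^sub>m (length cs)"
proof (intro eq_matI)
  let ?Q = "normalized_char_mat xs cs"
  fix i j assume "i < dim_row (1\<^sub>m (length cs) :: complex mat)"
    and "j < dim_col (1\<^sub>m (length cs) :: complex mat)"
  then have i: "i < length cs" and j: "j < length cs" by auto
  have dist: "distinct xs" "distinct cs" and set_xs: "set xs = A" and set_cs: "set cs = \<pi>"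
    using xs cs by (auto simp: ordering_of_def)
  have C: "cs ! i \<in> \<pi>" "cs ! j \<in> \<pi>" using i j set_cs by auto
  have sub: "cs ! i \<subseteq> A" and ne: "cs ! i \<noteq> {}"
    using C \<pi> by (auto simp: partition_on_def)
  have fin: "finite (cs ! i)" using sub set_xs finite_subset by blast
  have "(transpose_mat ?Q * ?Q) $$ (i, j) = (\<Sum>l<length xs. ?Q $$ (l, i) * ?Q $$ (l, j))"
    using i j by (simp add: normalized_char_mat_def scalar_prod_def lessThan_atLeast0)
  also have "\<dots> = 1\<^sub>m (length cs) $$ (i, j)"
  proof (cases "i = j")
    case True
    have "(\<Sum>l<length xs. ?Q $$ (l, i) * ?Q $$ (l, i)) =
      (\<Sum>l<length xs. if xs ! l \<in> cs ! i then 1 / of_nat (card (cs ! i)) else 0)"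
      using i by (intro sum.cong)
        (auto simp: normalized_char_mat_def simp flip: of_real_mult)
    \<comment> \<open>The list enumerates \<open>A\<close> without repetition, so positions can be
      exchanged for elements.\<close>
    also have "\<dots> = (\<Sum>x\<in>A. if x \<in> cs ! i then 1 / of_nat (card (cs ! i)) else 0)"
      using dist(1) set_xs by (intro sum.reindex_bij_betw bij_betw_nth) auto
    also have "\<dots> = (\<Sum>x\<in>cs ! i. 1 / of_nat (card (cs ! i)))"
      using sub set_xs by (intro sum.mono_neutral_cong_right) auto
    also have "\<dots> = 1"
      using fin ne by simp
    finally show ?thesis using True j by simp
  next
    case False
    then have "cs ! i \<noteq> cs ! j"
      using dist i j by (simp add: nth_eq_iff_index_eq)
    then have "cs ! i \<inter> cs ! j = {}"
      using C \<pi> by (auto simp: partition_on_def disjoint_def)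
    then have "?Q $$ (l, i) * ?Q $$ (l, j) = 0" if "l < length xs" for l
      using i j that by (auto simp: normalized_char_mat_def)
    then have "(\<Sum>l<length xs. ?Q $$ (l, i) * ?Q $$ (l, j)) = 0"
      by (intro sum.neutral) blast
    then show ?thesis using False i j by simp
  qed
  finally show "(transpose_mat ?Q * ?Q) $$ (i, j) = 1\<^sub>m (length cs) $$ (i, j)" .
qed (auto simp: normalized_char_mat_def)

text \<open>Arcs are counted by their tails. This is used for the quotient multigraph, whose number
  of arcs is the number of rows of \<open>Q'\<close>.\<close>

lemma card_arcs_regular:
  assumes fin: "finite (verts H)" "finite (arcs H)" and tail: "\<And>e. e \<in> arcs H \<Longrightarrow> tail H e \<in> verts H"
    and "regular_digraph d H"
  shows "card (arcs H) = card (verts H) * d"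
proof -
  have UN: "arcs H = (\<Union>v\<in>verts H. out_arcs H v)"
    using tail by (auto simp: out_arcs_def)
  have "card (arcs H) = (\<Sum>v\<in>verts H. card (out_arcs H v))"
    unfolding UN using fin by (intro card_UN_disjoint) (auto simp: out_arcs_def)
  also have "\<dots> = card (verts H) * d"
    using assms by (simp add: regular_digraph_def out_degree_def)
  finally show ?thesis .
qed

section \<open>Intertwined quantum walks\<close>

lemma pow_mat_intertwine:
  assumes "U \<in> carrier_mat M M" and "V \<in> carrier_mat M N" and "U' \<in> carrier_mat N N"
    and "U * V = V * U'"
  shows "U ^\<^sub>m k * V = V * U' ^\<^sub>m k"
proof (induction k)
  case 0
  then show ?case using assms by simp
next
  case (Suc k)
  have "U ^\<^sub>m Suc k * V = U ^\<^sub>m k * V * U'"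
    using assms by (simp add: assoc_mult_mat[of _ M M _ M _ N] assoc_mult_mat[of _ M M _ N _ N])
  also have "\<dots> = V * U' ^\<^sub>m Suc k"
    using assms by (simp add: Suc.IH assoc_mult_mat[of _ M N _ N _ N])
  finally show ?case .
qed

lemma mult_mat_vec_real_mat_conjugate:
  assumes "real_mat V" and V: "V \<in> carrier_mat M N" and x: "x \<in> carrier_vec N"
  shows "conjugate (V *\<^sub>v x) = V *\<^sub>v conjugate x"
proof (intro eq_vecI)
  fix i assume "i < dim_vec (V *\<^sub>v conjugate x)"
  then have "i < M" using V by simp
  then show "conjugate (V *\<^sub>v x) $ i = (V *\<^sub>v conjugate x) $ i"
    using assms by (auto simp: scalar_prod_def real_mat_def Reals_cnj_iff)
qed (use V in auto)

text \<open>As \<open>V\<close> is real, it commutes with the conjugation in the second argument, so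
  it moves to the other side as its transpose and cancels there.\<close>

lemma cscalar_prod_isometry:
  assumes "real_mat V" and V: "V \<in> carrier_mat M N" and VV: "transpose_mat V * V = 1\<^sub>m N"
    and x: "x \<in> carrier_vec N"
  shows "(V *\<^sub>v x) \<bullet>c (V *\<^sub>v x) = x \<bullet>c x"
proof -
  have "(V *\<^sub>v x) \<bullet>c (V *\<^sub>v x) = (transpose_mat V *\<^sub>v (V *\<^sub>v x)) \<bullet> conjugate x"
    using assms transpose_vec_mult_scalar[OF V, of "conjugate x" "V *\<^sub>v x"]
    by (simp add: mult_mat_vec_real_mat_conjugate)
  also have "transpose_mat V *\<^sub>v (V *\<^sub>v x) = x"
    using V x VV by (metis assoc_mult_mat_vec one_mult_mat_vec transpose_carrier_mat)
  finally show ?thesis .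
qed

text \<open>\<open>V\<close> carries the \<open>k\<close>-th power of one walk to that of the other
  and is injective, having its transpose as left inverse. Being an isometry, it also preserves unit
  vectors.\<close>

lemma perfect_state_transfer_intertwine:
  assumes U: "U \<in> carrier_mat M M" "unitary_matrix U"
    and U': "U' \<in> carrier_mat N N" "unitary_matrix U'"
    and V: "V \<in> carrier_mat M N" "real_mat V" "transpose_mat V * V = 1\<^sub>m N"
    and UV: "U * V = V * U'"
    and x: "x \<in> carrier_vec N" and y: "y \<in> carrier_vec N"
  shows "perfect_state_transfer U (V *\<^sub>v x) (V *\<^sub>v y) k \<longleftrightarrow> perfect_state_transfer U' x y k"
proof -
  have left_inv: "transpose_mat V *\<^sub>v (V *\<^sub>v z) = z" if "z \<in> carrier_vec N" for z
    using V that by (metis assoc_mult_mat_vec one_mult_mat_vec transpose_carrier_mat)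
  have pow: "(U ^\<^sub>m k) *\<^sub>v (V *\<^sub>v x) = V *\<^sub>v ((U' ^\<^sub>m k) *\<^sub>v x)"
    using pow_mat_intertwine[OF U(1) V(1) U'(1) UV, of k] U U' V x
    by (metis assoc_mult_mat_vec pow_carrier_mat)
  have smult: "\<gamma> \<cdot>\<^sub>v (V *\<^sub>v y) = V *\<^sub>v (\<gamma> \<cdot>\<^sub>v y)" for \<gamma>
    using V y by (simp add: mult_mat_vec)
  \<comment> \<open>The same phase \<gamma> serves both walks: with both sides written as images
    under \<open>V\<close>, the left inverse removes it.\<close>
  have "(U ^\<^sub>m k) *\<^sub>v (V *\<^sub>v x) = \<gamma> \<cdot>\<^sub>v (V *\<^sub>v y) \<longleftrightarrow> (U' ^\<^sub>m k) *\<^sub>v x = \<gamma> \<cdot>\<^sub>v y" for \<gamma>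
    unfolding pow smult using U' x y
    by (metis left_inv mult_mat_vec_carrier pow_carrier_mat smult_carrier_vec)
  then show ?thesis
    using U U' V x y
    by (simp add: perfect_state_transfer_def unit_vector_def cscalar_prod_isometry[OF V(2,1,3)])
qed

theorem theorem4p1p3:
  fixes G :: "('a, 'b) pre_digraph"
    and \<pi> :: "'a set set"
    and n d :: nat
    and vs :: "'a list" and cs :: "'a set list"
    and as :: "'b list" and ts :: "'b set list"
    and bs :: "('a set \<times> 'a set \<times> nat) list" and ss :: "('a set \<times> 'a set \<times> nat) set list"
    and \<tau> :: "'b set set" and \<sigma> :: "('a set \<times> 'a set \<times> nat) set set"
    and P P' :: "nat \<Rightarrow> complex mat"
    and Q Q\<tau> Q' S S' R R' U U' :: "complex mat"
  assumes "fin_digraph G" and "nomulti_digraph G"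
    and "regular_digraph d G" and "card (verts G) = 2 * n"
    and "equitable_partition G \<pi>" and "card \<pi> = n" and "equal_cells \<pi>"
    and "regular_digraph d (quotient_digraph G \<pi>)"
    and "\<tau> = terminal_partition G"
    and "equitable_partition (line_digraph G) \<tau>" and "equal_cells \<tau>"
    and "\<sigma> = terminal_partition (quotient_digraph G \<pi>)"
    and "equitable_partition (line_digraph (quotient_digraph G \<pi>)) \<sigma>" and "equal_cells \<sigma>"
    and "ordering_of vs (verts G)" and "ordering_of cs \<pi>"
    and "ordering_of as (arcs G)" and "ordering_of ts \<tau>"
    and "ordering_of bs (arcs (quotient_digraph G \<pi>))" and "ordering_of ss \<sigma>"
    and "Q = normalized_char_mat vs cs"
    and "Q\<tau> = normalized_char_mat as ts"
    and "Q' = normalized_char_mat bs ss"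
    and "Q\<tau> = 1\<^sub>m d \<otimes>\<^sub>m Q'" and "Q' = Q"
    and "shunt_decomposition (2 * n) d (adjacency_mat G vs) P"
    and "shunt_decomposition n d (adjacency_mat (quotient_digraph G \<pi>) cs) P'"
    and "\<forall>j<d. P j * Q = Q * P' j"
    and "S = matrix_sum (d * (2 * n)) d (\<lambda>j. diag_unit d j \<otimes>\<^sub>m P j)"
    and "S' = matrix_sum (d * n) d (\<lambda>j. diag_unit d j \<otimes>\<^sub>m P' j)"
    and "R = 2 \<cdot>\<^sub>m (Q\<tau> * (Q' * transpose_mat Q') * transpose_mat Q\<tau>) - 1\<^sub>m (d * (2 * n))"
    and "R' = 2 \<cdot>\<^sub>m (Q' * transpose_mat Q') - 1\<^sub>m (d * n)"
    and "U = S * R" and "U' = S' * R'"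
  shows "\<forall>x \<in> mat_image Q'. \<forall>y \<in> mat_image Q'. \<forall>k.
           perfect_state_transfer U (Q\<tau> *\<^sub>v x) (Q\<tau> *\<^sub>v y) k \<longleftrightarrow>
           perfect_state_transfer U' x y k"
proof -

  \<comment> \<open>Sizes of the matrices and the isometry \<open>Q\<close>\<close>
  have \<pi>: "partition_on (verts G) \<pi>"
    using assms(5) by (simp add: equitable_partition_def)
  have len_vs: "length vs = 2 * n" and len_cs: "length cs = n" and fin_\<pi>: "finite \<pi>"
    using assms(4,6,15,16) by (auto simp: ordering_of_def distinct_card[symmetric])
  have Q: "Q \<in> carrier_mat (2 * n) n"
    by (simp add: assms(21) normalized_char_mat_def len_vs len_cs)
  have realQ: "real_mat Q"
    by (simp add: assms(21) real_mat_normalized_char_mat)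
  have QQ: "transpose_mat Q * Q = 1\<^sub>m n"
    using transpose_mult_normalized_char_mat[OF assms(15,16) \<pi>] by (simp add: assms(21) len_cs)
  \<comment> \<open>\<open>Q' = Q\<close> forces the quotient to have as many arcs as \<open>G\<close> has vertices,
    so that \<open>Q\<tau> * Q\<close> is a product of matrices of matching sizes.\<close>
  have "length bs = n * d"
  proof -
    let ?H = "quotient_digraph G \<pi>"
    have "finite (arcs ?H)"
      using assms(19) by (metis List.finite_set ordering_of_def)
    then have "card (arcs ?H) = card (verts ?H) * d"
      using fin_\<pi> assms(8)
      by (intro card_arcs_regular) (auto simp: quotient_digraph_def)
    then show ?thesis
      using assms(6,19) by (auto simp: ordering_of_def distinct_card[symmetric] quotient_digraph_def)
  qed
  \<comment> \<open>Row counts are compared: \<open>Q'\<close> has one row per arc of the quotient,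
    \<open>Q\<close> one per vertex of \<open>G\<close>.\<close>
  moreover have "length bs = 2 * n"
    using Q assms(23,25) by (auto simp: normalized_char_mat_def)
  \<comment> \<open>For \<open>n > 0\<close> this means \<open>d = 2\<close>; the equation in this
    form also covers \<open>n = 0\<close>.\<close>
  ultimately have dim: "2 * n = d * n"
    by (metis mult.commute)
  \<comment> \<open>In this form every identity relating \<open>Q\<tau>\<close> to the shifts can be
    checked block by block.\<close>
  have Q\<tau>: "Q\<tau> = block_diag d (2 * n) n (\<lambda>_. Q)"
    using assms(24,25) kronecker_one_left[OF Q] by simp
  have Q\<tau>_carrier: "Q\<tau> \<in> carrier_mat (d * (2 * n)) (d * n)"
    by (simp add: Q\<tau>)
  have realQ\<tau>: "real_mat Q\<tau>"
    unfolding Q\<tau> using Q realQ by (intro real_mat_block_diag)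
  have Q\<tau>Q\<tau>: "transpose_mat Q\<tau> * Q\<tau> = 1\<^sub>m (d * n)"
    using Q by (simp add: Q\<tau> transpose_block_diag block_diag_mult QQ block_diag_one)

  \<comment> \<open>The shifts: orthogonality and intertwining\<close>
  have shunt: "permutation_matrix (2 * n) (P j)" "permutation_matrix n (P' j)" if "j < d" for j
    using assms(26,27) that by (auto simp: shunt_decomposition_def)
  then have P: "P j \<in> carrier_mat (2 * n) (2 * n)" and P': "P' j \<in> carrier_mat n n" if "j < d" for j
    using that by (auto simp: permutation_matrix_def)
  have S: "S = block_diag d (2 * n) (2 * n) P" and S': "S' = block_diag d n n P'"
    using P P' assms(29,30) by (simp_all add: matrix_sum_diag_unit_kronecker)
  have S_carrier: "S \<in> carrier_mat (d * (2 * n)) (d * (2 * n))"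
    and S'_carrier: "S' \<in> carrier_mat (d * n) (d * n)"
    by (simp_all add: S S')
  have real_S: "real_mat S" "real_mat S'"
    unfolding S S' using P P' shunt by (blast intro: real_mat_block_diag real_mat_permutation)+
  have SS: "transpose_mat S * S = 1\<^sub>m (d * (2 * n))"
  proof -
    have "transpose_mat S * S = block_diag d (2 * n) (2 * n) (\<lambda>j. transpose_mat (P j) * P j)"
      using P by (simp add: S transpose_block_diag block_diag_mult)
    also have "\<dots> = block_diag d (2 * n) (2 * n) (\<lambda>_. 1\<^sub>m (2 * n))"
      by (intro block_diag_cong) (simp add: transpose_mult_permutation shunt)
    finally show ?thesis by (simp add: block_diag_one)
  qed
  have SS': "transpose_mat S' * S' = 1\<^sub>m (d * n)"
  proof -
    have "transpose_mat S' * S' = block_diag d n n (\<lambda>j. transpose_mat (P' j) * P' j)"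
      using P' by (simp add: S' transpose_block_diag block_diag_mult)
    also have "\<dots> = block_diag d n n (\<lambda>_. 1\<^sub>m n)"
      by (intro block_diag_cong) (simp add: transpose_mult_permutation shunt)
    finally show ?thesis by (simp add: block_diag_one)
  qed
  have SQ: "S * Q\<tau> = Q\<tau> * S'"
  proof -
    have "S * Q\<tau> = block_diag d (2 * n) n (\<lambda>j. P j * Q)"
      using P Q by (simp add: S Q\<tau> block_diag_mult)
    also have "\<dots> = block_diag d (2 * n) n (\<lambda>j. Q * P' j)"
      using assms(28) by (intro block_diag_cong) simp
    also have "\<dots> = Q\<tau> * S'"
      using P' Q by (simp add: S' Q\<tau> block_diag_mult)
    finally show ?thesis .
  qed

  \<comment> \<open>The reflections: orthogonality and intertwining\<close>
  let ?m = "d * n" and ?M = "d * (2 * n)"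
  \<comment> \<open>Here \<open>Q\<close> acts in its second role, as \<open>Q'\<close>, with rows
    indexed by the arcs of the quotient.\<close>
  have Qm: "Q \<in> carrier_mat ?m n"
    using Q dim by simp
  let ?V = "Q\<tau> * Q" and ?K = "Q * transpose_mat Q"
  have V: "?V \<in> carrier_mat ?M n" "real_mat ?V" "transpose_mat ?V * ?V = 1\<^sub>m n"
    using Q\<tau>_carrier Qm realQ realQ\<tau> transpose_mult_orthogonal[OF Q\<tau>_carrier Qm Q\<tau>Q\<tau> QQ]
    by (auto intro!: real_mat_mult)
  have K: "?K \<in> carrier_mat ?m ?m"
    using Qm by simp
  \<comment> \<open>Regrouping exhibits the projection in \<open>R\<close> as \<open>V V^T\<close>
    for the isometry \<open>V = Q\<tau> Q\<close>, as the lemma on reflections requires.\<close>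
  have "?V * transpose_mat ?V = Q\<tau> * ?K * transpose_mat Q\<tau>"
    using Q\<tau>_carrier Qm
    by (simp add: transpose_mult[OF Q\<tau>_carrier Qm] assoc_mult_mat[of _ ?M ?m _ n _ ?M]
      assoc_mult_mat[of _ ?M ?m _ ?m _ ?M] assoc_mult_mat[of _ ?m n _ ?m _ ?M])
  then have R: "R = 2 \<cdot>\<^sub>m (?V * transpose_mat ?V) - 1\<^sub>m ?M"
    using assms(25,31) by simp
  have R': "R' = 2 \<cdot>\<^sub>m ?K - 1\<^sub>m ?m"
    using assms(25,32) by simp
  note reflR = reflection_real_orthogonal[OF V, folded R]
  note reflR' = reflection_real_orthogonal[OF Qm realQ QQ, folded R']
  have RQ: "R * Q\<tau> = Q\<tau> * R'"
  proof -
    have "(Q\<tau> * ?K * transpose_mat Q\<tau>) * Q\<tau> = Q\<tau> * ?K * (transpose_mat Q\<tau> * Q\<tau>)"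
      using Q\<tau>_carrier K by (intro assoc_mult_mat[of _ ?M ?m _ ?M _ ?m]) auto
    also have "\<dots> = Q\<tau> * ?K"
      unfolding Q\<tau>Q\<tau> using mult_carrier_mat[OF Q\<tau>_carrier K] by (rule right_mult_one_mat)
    finally have *: "(Q\<tau> * ?K * transpose_mat Q\<tau>) * Q\<tau> = Q\<tau> * ?K" .
    have L: "Q\<tau> * ?K * transpose_mat Q\<tau> \<in> carrier_mat ?M ?M"
      using Q\<tau>_carrier K by auto
    have "R * Q\<tau> = 2 \<cdot>\<^sub>m ((Q\<tau> * ?K * transpose_mat Q\<tau>) * Q\<tau>) - 1\<^sub>m ?M * Q\<tau>"
      unfolding assms(31,25) using L Q\<tau>_carrier
      by (subst minus_mult_distrib_mat[of _ ?M ?M _ _ ?m])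
         (auto simp del: assoc_mult_mat simp: mult_smult_assoc_mat[of _ ?M ?M _ ?m])
    \<comment> \<open>The identity is moved to the right of \<open>Q\<tau>\<close>, so that
      \<open>Q\<tau>\<close> can be factored out on the left.\<close>
    also have "\<dots> = 2 \<cdot>\<^sub>m (Q\<tau> * ?K) - Q\<tau> * 1\<^sub>m ?m"
      using Q\<tau>_carrier unfolding * by simp
    also have "\<dots> = Q\<tau> * R'"
      unfolding R' using Q\<tau>_carrier K
      by (simp del: assoc_mult_mat
        add: mult_minus_distrib_mat[of _ ?M ?m _ ?m] mult_smult_distrib[of _ ?M ?m _ ?m])
    finally show ?thesis .
  qed

  \<comment> \<open>The walks: intertwining, unitarity and transfer\<close>
  have "U * Q\<tau> = S * (R * Q\<tau>)"
    using S_carrier reflR(1) Q\<tau>_carrier assms(33) by simp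
  also have "\<dots> = (S * Q\<tau>) * R'"
    using S_carrier reflR'(1) Q\<tau>_carrier by (simp add: RQ)
  also have "\<dots> = Q\<tau> * U'"
    using S'_carrier reflR'(1) Q\<tau>_carrier assms(34) unfolding SQ by simp
  finally have UQ: "U * Q\<tau> = Q\<tau> * U'" .
  have "U \<in> carrier_mat ?M ?M" "unitary_matrix U" "U' \<in> carrier_mat ?m ?m" "unitary_matrix U'"
    using S_carrier S'_carrier real_S SS SS' reflR reflR' unfolding assms(33,34)
    by (auto intro!: unitary_matrix_mult_real)
  note intertwine = perfect_state_transfer_intertwine[OF this Q\<tau>_carrier realQ\<tau> Q\<tau>Q\<tau> UQ]
  have "z \<in> carrier_vec ?m" if "z \<in> mat_image Q'" for z
    using that Qm assms(25) by (auto simp: mat_image_def)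
  then show ?thesis
    by (intro ballI allI intertwine)
qed

end
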